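(* Let $N\ge 2$, let $m_1,\dots,m_N>0$ be masses, $G>0$, and let $q_i^0,v_i^0\in\mathbb{R}^3$ ($1\le i\le N$) satisfy $q_i^0\neq q_j^0$ for all $1\le i<j\le N$. Let $(q,v)=(q_1,\ldots,q_N,v_1,\ldots,v_N)\in\mathbb{R}^{6N}[[t]]$ be the power series solution of the $N$-body equations $$\frac{dq_i}{dt}=v_i,\qquad \frac{dv_i}{dt}=g_i(q),\qquad q_i(0)=q_i^0,\quad v_i(0)=v_i^0,\qquad i=1,\ldots,N.$$ Let $\rho=\sum_{k\ge0}\rho_k t^k\in\mathbb{R}_+[[t]]$ be the unique power series solution of the initial value problem $$\rho''=\nu(q^0)\,\frac{\rho}{(2-\rho^2)^{3/2}},\qquad \rho(0)=1,\qquad \rho'(0)=\mu(q^0,v^0).$$ Then $$q_i-q_j\trianglelefteq \|q_i^0-q_j^0\|\,\rho\qquad\text{for all }1\le i<j\le N.$$ Furthermore, for each $i=1,\ldots,N$, $$q_i-q_i^0-t\,v_i^0\ \trianglelefteq\ \min_{1\le j\le N,\ j\neq i}\|q_i^0-q_j^0\|\ \sum_{k=2}^{\infty}\rho_k\,t^k .$$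
   Context: $\mathbb{R}_+=\{x\in\mathbb{R}: x\ge 0\}$ and $\|\cdot\|$ is the Euclidean norm. For $f=\sum_{k\ge0}f_kt^k\in\mathbb{R}^n[[t]]$ and $\bar f=\sum_{k\ge0}\bar f_kt^k\in\mathbb{R}[[t]]$, $f\trianglelefteq\bar f$ ($f$ is majored by $\bar f$) means $\|f_k\|\le\bar f_k$ for all $k\ge0$. Derivatives of formal power series are taken termwise; for a scalar series $p$ with positive constant term and real $\nu$, $p^\nu$ denotes the usual formal power series. For $q=(q_1,\dots,q_N)$, $v=(v_1,\dots,v_N)$ with $q_i,v_i\in\mathbb{R}^3$ and $q_i\ne q_j$ for $i\neq j$: $$g_i(q)=\sum_{j\neq i}\frac{G\,m_j}{\|q_i-q_j\|^3}(q_j-q_i),\qquad K_i(q)=\sum_{j\neq i}\frac{G\,m_j}{\|q_i-q_j\|^2},\qquad M_{ij}(q)=K_i(q)+K_j(q),$$ $$\mu(q,v)=\max_{1\le i<j\le N}\frac{\|v_i-v_j\|}{\|q_i-q_j\|},\qquad \nu(q)=\max_{1\le i<j\le N}\frac{M_{ij}(q)}{\|q_i-q_j\|}.$$ Also $q^0=(q_1^0,\dots,q_N^0)$, $v^0=(v_1^0,\dots,v_N^0)$. Since the right-hand side is analytic away from collisions, the initial value problem has a unique formal power series solution. *)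

theory Defs
  imports "HOL-Analysis.Analysis" "HOL-Computational_Algebra.Formal_Power_Series"
begin

section \<open>Real and vector-valued formal power series\<close>

text \<open>
  Elements of \<open>\<real>\<^sup>n[[t]]\<close> are series of type \<open>(real ^ 'n) fps\<close>, with vectors as coefficients.
  The library derivative \<^const>\<open>fps_deriv\<close> applies to them because \<open>real ^ 'n\<close> carries the
  componentwise ring structure; it is the termwise derivative (\<open>fps_deriv_vec_nth\<close> below).
\<close>

lemma fps_deriv_vec_nth:
  "fps_nth (fps_deriv (f :: (real ^ 'n) fps)) k = real (Suc k) *\<^sub>R fps_nth f (Suc k)"
  by (simp add: vec_eq_iff of_nat_index del: of_nat_Suc)

text \<open>
  The power \<open>p\<^sup>a\<close> of a series with constant term \<open>p\<^sub>0 > 0\<close> is \<open>p\<^sub>0\<^sup>a (1 + u)\<^sup>a\<close> with \<open>u = p / p\<^sub>0 - 1\<close>,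
  where \<open>(1 + u)\<^sup>a\<close> is given by the binomial series.
\<close>

definition fps_rpow :: "real fps \<Rightarrow> real \<Rightarrow> real fps" where
  "fps_rpow p a =
     fps_const (fps_nth p 0 powr a) *
     fps_compose (fps_binomial a) (fps_const (1 / fps_nth p 0) * p - 1)"

definition fps_scaleR :: "real fps \<Rightarrow> 'a::real_vector fps \<Rightarrow> 'a fps" where
  "fps_scaleR p f = Abs_fps (\<lambda>n. \<Sum>k\<le>n. fps_nth p k *\<^sub>R fps_nth f (n - k))"

definition fps_norm_sq :: "'a::real_inner fps \<Rightarrow> real fps" where
  "fps_norm_sq f = Abs_fps (\<lambda>n. \<Sum>k\<le>n. fps_nth f k \<bullet> fps_nth f (n - k))"

definition majored_by :: "'a::real_normed_vector fps \<Rightarrow> real fps \<Rightarrow> bool"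
  (infix \<open>\<unlhd>\<close> 50) where
  "f \<unlhd> fbar \<longleftrightarrow> (\<forall>k. norm (fps_nth f k) \<le> fps_nth fbar k)"


section \<open>The N-body problem\<close>

text \<open>
  Bodies are indexed by \<open>{1..N}\<close>; positions, velocities and masses are functions on \<^typ>\<open>nat\<close>
  whose values outside \<open>{1..N}\<close> play no role.
\<close>

definition grav_K :: "nat \<Rightarrow> real \<Rightarrow> (nat \<Rightarrow> real) \<Rightarrow> (nat \<Rightarrow> real ^ 3) \<Rightarrow> nat \<Rightarrow> real" where
  "grav_K N G m q i = (\<Sum>j\<in>{1..N} - {i}. G * m j / norm (q i - q j) ^ 2)"

definition grav_M ::
    "nat \<Rightarrow> real \<Rightarrow> (nat \<Rightarrow> real) \<Rightarrow> (nat \<Rightarrow> real ^ 3) \<Rightarrow> nat \<Rightarrow> nat \<Rightarrow> real" where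
  "grav_M N G m q i j = grav_K N G m q i + grav_K N G m q j"

definition grav_mu :: "nat \<Rightarrow> (nat \<Rightarrow> real ^ 3) \<Rightarrow> (nat \<Rightarrow> real ^ 3) \<Rightarrow> real" where
  "grav_mu N q v = Max {norm (v i - v j) / norm (q i - q j) | i j. 1 \<le> i \<and> i < j \<and> j \<le> N}"

definition grav_nu :: "nat \<Rightarrow> real \<Rightarrow> (nat \<Rightarrow> real) \<Rightarrow> (nat \<Rightarrow> real ^ 3) \<Rightarrow> real" where
  "grav_nu N G m q = Max {grav_M N G m q i j / norm (q i - q j) | i j. 1 \<le> i \<and> i < j \<and> j \<le> N}"

text \<open>
  The acceleration \<open>g\<^sub>i(q)\<close> at power series positions, where \<open>\<parallel>q\<^sub>i - q\<^sub>j\<parallel>\<^sup>3\<close> is the series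
  \<open>(\<parallel>q\<^sub>i - q\<^sub>j\<parallel>\<^sup>2)\<^sup>3\<^sup>/\<^sup>2\<close>.
\<close>

definition grav_g_fps ::
    "nat \<Rightarrow> real \<Rightarrow> (nat \<Rightarrow> real) \<Rightarrow> (nat \<Rightarrow> (real ^ 3) fps) \<Rightarrow> nat \<Rightarrow> (real ^ 3) fps" where
  "grav_g_fps N G m q i =
     (\<Sum>j\<in>{1..N} - {i}.
        fps_scaleR (fps_const (G * m j) / fps_rpow (fps_norm_sq (q i - q j)) (3/2)) (q j - q i))"

definition nbody_series_solution ::
    "nat \<Rightarrow> real \<Rightarrow> (nat \<Rightarrow> real) \<Rightarrow> (nat \<Rightarrow> real ^ 3) \<Rightarrow> (nat \<Rightarrow> real ^ 3) \<Rightarrow>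
     (nat \<Rightarrow> (real ^ 3) fps) \<Rightarrow> (nat \<Rightarrow> (real ^ 3) fps) \<Rightarrow> bool" where
  "nbody_series_solution N G m q0 v0 q v \<longleftrightarrow>
     (\<forall>i\<in>{1..N}.
        fps_deriv (q i) = v i \<and>
        fps_deriv (v i) = grav_g_fps N G m q i \<and>
        fps_nth (q i) 0 = q0 i \<and>
        fps_nth (v i) 0 = v0 i)"

definition majorant_series_solution :: "real \<Rightarrow> real \<Rightarrow> real fps \<Rightarrow> bool" where
  "majorant_series_solution nu mu \<rho> \<longleftrightarrow>
     fps_deriv (fps_deriv \<rho>) = fps_const nu * (\<rho> / fps_rpow (2 - \<rho>\<^sup>2) (3/2)) \<and>
     fps_nth \<rho> 0 = 1 \<and>
     fps_nth (fps_deriv \<rho>) 0 = mu"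


section \<open>Existence and uniqueness of the series solutions\<close>

lemma fps_compose_prod_binomial:
  assumes "fps_nth u 0 = (0::real)"
  shows "fps_compose (fps_binomial a) u * fps_compose (fps_binomial b) u
         = fps_compose (fps_binomial (a + b)) u"
  using assms by (simp add: fps_binomial_add_mult fps_compose_mult_distrib)

lemma fps_rpow_nth_0: "fps_nth (fps_rpow p a) 0 = fps_nth p 0 powr a"
  by (simp add: fps_rpow_def)

lemma fps_rpow_add:
  assumes "fps_nth p 0 > 0"
  shows "fps_rpow p (a + b) = fps_rpow p a * fps_rpow p b"
proof -
  define u where "u = fps_const (1 / fps_nth p 0) * p - 1"
  have "fps_nth u 0 = 0" using assms by (simp add: u_def)
  note bin = fps_compose_prod_binomial[OF this, of a b]
  show ?thesis
    unfolding fps_rpow_def u_def[symmetric] powr_add bin[symmetric] fps_const_mult[symmetric]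
    by (simp only: ac_simps)
qed

lemma fps_rpow_of_nat:
  assumes "fps_nth p 0 > 0"
  shows "fps_rpow p (real n) = p ^ n"
proof (induction n)
  case 0
  then show ?case using assms by (simp add: fps_rpow_def)
next
  case (Suc n)
  have "fps_rpow p 1 = p"
    using assms
    by (simp add: fps_rpow_def fps_binomial_1 fps_compose_add_distrib fps_eq_iff)
  with Suc fps_rpow_add[OF assms, of 1 "real n"] show ?case by simp
qed

lemma divide_fps_rpow:
  assumes "fps_nth p 0 \<ge> 0"
  shows "f / fps_rpow p a = f * fps_rpow p (- a)"
proof (cases "fps_nth p 0 = 0")
  case True
  then have "fps_rpow p b = 0" for b by (simp add: fps_rpow_def)
  then show ?thesis by simp
next
  case False
  with assms have pos: "fps_nth p 0 > 0" by simp
  have "fps_rpow p a * fps_rpow p (- a) = 1"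
    using fps_rpow_add[OF pos, of a "- a"] fps_rpow_of_nat[OF pos, of 0] by simp
  then have "inverse (fps_rpow p a) = fps_rpow p (- a)"
    by (simp add: fps_inverse_unique)
  moreover have "fps_nth (fps_rpow p a) 0 \<noteq> 0" using pos by (simp add: fps_rpow_nth_0)
  ultimately show ?thesis by (simp add: fps_divide_unit)
qed

definition fps_agree :: "nat \<Rightarrow> 'a::zero fps \<Rightarrow> 'a fps \<Rightarrow> bool" where
  "fps_agree n f g \<longleftrightarrow> (\<forall>k\<le>n. fps_nth f k = fps_nth g k)"

lemma fps_agree_refl [simp]: "fps_agree n f f"
  by (simp add: fps_agree_def)

lemma fps_agree_diff:
  fixes f g :: "'a::group_add fps"
  shows "fps_agree n f f' \<Longrightarrow> fps_agree n g g' \<Longrightarrow> fps_agree n (f - g) (f' - g')"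
  by (simp add: fps_agree_def)

lemma fps_agree_mult:
  fixes f g :: "real fps"
  shows "fps_agree n f f' \<Longrightarrow> fps_agree n g g' \<Longrightarrow> fps_agree n (f * g) (f' * g')"
  by (auto simp: fps_agree_def fps_mult_nth intro!: sum.cong)

lemma fps_agree_power:
  fixes f :: "real fps"
  shows "fps_agree n f f' \<Longrightarrow> fps_agree n (f ^ k) (f' ^ k)"
  by (induction k) (auto intro: fps_agree_mult)

lemma fps_agree_rpow:
  assumes "fps_agree n p p'"
  shows "fps_agree n (fps_rpow p a) (fps_rpow p' a)"
proof -
  define c where "c = fps_nth p 0"
  have c': "fps_nth p' 0 = c" using assms by (simp add: c_def fps_agree_def)
  let ?u = "fps_const (1 / c) * p - 1" and ?u' = "fps_const (1 / c) * p' - 1"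
  have "fps_agree n ?u ?u'"
    using assms by (intro fps_agree_diff fps_agree_mult) auto
  then have "fps_agree n (?u ^ k) (?u' ^ k)" for k by (rule fps_agree_power)
  then have "fps_agree n (fps_compose (fps_binomial a) ?u) (fps_compose (fps_binomial a) ?u')"
    by (auto simp: fps_agree_def fps_compose_nth intro!: sum.cong)
  then show ?thesis
    unfolding fps_rpow_def c' c_def[symmetric] by (intro fps_agree_mult) auto
qed

lemma fps_agree_scaleR:
  "fps_agree n p p' \<Longrightarrow> fps_agree n f f' \<Longrightarrow> fps_agree n (fps_scaleR p f) (fps_scaleR p' f')"
  by (auto simp: fps_agree_def fps_scaleR_def intro!: sum.cong)

lemma fps_agree_norm_sq:
  "fps_agree n f f' \<Longrightarrow> fps_agree n (fps_norm_sq f) (fps_norm_sq f')"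
  by (auto simp: fps_agree_def fps_norm_sq_def intro!: sum.cong)

lemma fps_agree_sum:
  fixes f :: "'b \<Rightarrow> 'a::comm_monoid_add fps"
  assumes "\<And>j. j \<in> A \<Longrightarrow> fps_agree n (f j) (f' j)"
  shows "fps_agree n (sum f A) (sum f' A)"
  using assms by (auto simp: fps_agree_def fps_sum_nth intro!: sum.cong)

lemma fps_agree_grav_g:
  assumes "\<And>j. j \<in> {1..N} \<Longrightarrow> fps_agree n (q j) (q' j)" and "i \<in> {1..N}"
  shows "fps_agree n (grav_g_fps N G m q i) (grav_g_fps N G m q' i)"
proof -
  have "fps_nth (fps_norm_sq f) 0 \<ge> 0" for f :: "(real ^ 3) fps"
    by (simp add: fps_norm_sq_def)
  then have *: "c / fps_rpow (fps_norm_sq f) (3/2) = c * fps_rpow (fps_norm_sq f) (- (3/2))"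
    for c and f :: "(real ^ 3) fps"
    by (rule divide_fps_rpow)
  show ?thesis
    unfolding grav_g_fps_def *
    using assms
    by (intro fps_agree_sum fps_agree_scaleR fps_agree_mult fps_agree_rpow fps_agree_norm_sq
          fps_agree_diff fps_agree_refl) auto
qed

lemma exists_causal_sequence:
  fixes F :: "(nat \<Rightarrow> 'a) \<Rightarrow> nat \<Rightarrow> 'a"
  assumes F: "\<And>c c' n. (\<And>k. k \<le> n \<Longrightarrow> c k = c' k) \<Longrightarrow> F c n = F c' n"
  shows "\<exists>c. c 0 = a \<and> (\<forall>n. c (Suc n) = F c n)"
proof -
  define S where "S = rec_nat (\<lambda>_. a) (\<lambda>n s. s(Suc n := F s n))"
  have S0: "S 0 = (\<lambda>_. a)" and S1: "S (Suc n) = (S n)(Suc n := F (S n) n)" for n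
    by (simp_all add: S_def)
  have stable: "S (k + d) k = S k k" for k d
    by (induction d) (simp_all add: S0 S1)
  define c where "c n = S n n" for n
  have "c (Suc n) = F c n" for n
  proof -
    have "c (Suc n) = F (S n) n" by (simp add: c_def S1)
    also have "\<dots> = F c n"
      by (rule F) (metis stable c_def le_add_diff_inverse)
    finally show ?thesis .
  qed
  moreover have "c 0 = a" by (simp add: c_def S0)
  ultimately show ?thesis by blast
qed

lemma nbody_series_solution_exists:
  "\<exists>q v. nbody_series_solution N G m q0 v0 q v"
proof -
  define Q :: "(nat \<Rightarrow> nat \<Rightarrow> (real ^ 3) \<times> (real ^ 3)) \<Rightarrow> nat \<Rightarrow> (real ^ 3) fps"
    where "Q c j = Abs_fps (\<lambda>k. fst (c k j))" for c j
  define F :: "(nat \<Rightarrow> nat \<Rightarrow> (real ^ 3) \<times> (real ^ 3)) \<Rightarrow> nat \<Rightarrow> nat \<Rightarrow> (real ^ 3) \<times> (real ^ 3)"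
    where "F c n = (\<lambda>i. if i \<in> {1..N}
            then ((1 / real (Suc n)) *\<^sub>R snd (c n i),
                  (1 / real (Suc n)) *\<^sub>R fps_nth (grav_g_fps N G m (Q c) i) n)
            else (0, 0))" for c n
  have "F c n = F c' n" if "\<And>k. k \<le> n \<Longrightarrow> c k = c' k" for c c' n
  proof
    fix i
    have "fps_agree n (Q c j) (Q c' j)" for j
      using that by (simp add: fps_agree_def Q_def)
    then have "i \<in> {1..N} \<Longrightarrow>
        fps_agree n (grav_g_fps N G m (Q c) i) (grav_g_fps N G m (Q c') i)"
      by (rule fps_agree_grav_g)
    then show "F c n i = F c' n i"
      using that by (simp add: F_def fps_agree_def)
  qed
  from exists_causal_sequence[of F, OF this]
  obtain c where c0: "c 0 = (\<lambda>i. (q0 i, v0 i))" and c1: "\<And>n. c (Suc n) = F c n"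
    by blast
  define v where "v i = Abs_fps (\<lambda>k. snd (c k i))" for i
  have "nbody_series_solution N G m q0 v0 (Q c) v"
    unfolding nbody_series_solution_def
  proof (intro ballI conjI)
    fix i assume i: "i \<in> {1..N}"
    show "fps_deriv (Q c i) = v i"
      using i by (simp add: fps_eq_iff fps_deriv_vec_nth Q_def v_def c1 F_def del: fps_deriv_nth of_nat_Suc)
    have "fps_nth (v i) (Suc n) = (1 / real (Suc n)) *\<^sub>R fps_nth (grav_g_fps N G m (Q c) i) n" for n
      using i by (simp add: v_def c1 F_def)
    then show "fps_deriv (v i) = grav_g_fps N G m (Q c) i"
      by (simp add: fps_eq_iff fps_deriv_vec_nth del: fps_deriv_nth of_nat_Suc)
  qed (simp_all add: Q_def v_def c0)
  then show ?thesis by blast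
qed

lemma nbody_series_solution_unique:
  assumes sol: "nbody_series_solution N G m q0 v0 q v"
    and sol': "nbody_series_solution N G m q0 v0 q' v'"
    and "i \<in> {1..N}"
  shows "q i = q' i \<and> v i = v' i"
proof -
  have step: "fps_nth f (Suc n) = fps_nth f' (Suc n)"
    if "fps_nth (fps_deriv f) n = fps_nth (fps_deriv f') n" for f f' :: "(real ^ 3) fps" and n
    using that by (simp add: fps_deriv_vec_nth del: fps_deriv_nth of_nat_Suc)
  have "\<forall>i\<in>{1..N}. fps_agree n (q i) (q' i) \<and> fps_agree n (v i) (v' i)" for n
  proof (induction n)
    case 0
    then show ?case using sol sol' by (simp add: nbody_series_solution_def fps_agree_def)
  next
    case (Suc n)
    show ?case
    proof
      fix i assume i: "i \<in> {1..N}"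
      have "fps_agree n (grav_g_fps N G m q i) (grav_g_fps N G m q' i)"
        using Suc i by (intro fps_agree_grav_g) auto
      then have "fps_nth (fps_deriv (v i)) n = fps_nth (fps_deriv (v' i)) n"
        using sol sol' i by (simp add: nbody_series_solution_def fps_agree_def del: fps_deriv_nth)
      moreover have "fps_nth (fps_deriv (q i)) n = fps_nth (fps_deriv (q' i)) n"
        using sol sol' i Suc by (simp add: nbody_series_solution_def fps_agree_def del: fps_deriv_nth)
      ultimately have "fps_nth (q i) (Suc n) = fps_nth (q' i) (Suc n)"
          "fps_nth (v i) (Suc n) = fps_nth (v' i) (Suc n)"
        by (blast intro: step)+
      moreover have "fps_agree n (q i) (q' i)" "fps_agree n (v i) (v' i)"
        using Suc i by blast+
      ultimately show "fps_agree (Suc n) (q i) (q' i) \<and> fps_agree (Suc n) (v i) (v' i)"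
        by (simp add: fps_agree_def le_Suc_eq)
    qed
  qed
  then have "fps_agree n (q i) (q' i)" "fps_agree n (v i) (v' i)" for n
    using assms(3) by blast+
  then show ?thesis
    by (meson fps_agree_def fps_ext order_refl)
qed

definition majorant_rhs :: "real fps \<Rightarrow> real fps" where
  "majorant_rhs \<rho> = \<rho> * fps_rpow (2 - \<rho>\<^sup>2) (- (3/2))"

lemma majorant_series_solution_alt:
  "majorant_series_solution nu mu \<rho> \<longleftrightarrow>
     fps_deriv (fps_deriv \<rho>) = fps_const nu * majorant_rhs \<rho> \<and>
     fps_nth \<rho> 0 = 1 \<and> fps_nth \<rho> 1 = mu"
proof -
  have "\<rho> / fps_rpow (2 - \<rho>\<^sup>2) (3/2) = majorant_rhs \<rho>" if "fps_nth \<rho> 0 = 1"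
    unfolding majorant_rhs_def
    by (rule divide_fps_rpow) (simp add: that fps_numeral_nth power2_eq_square)
  then show ?thesis by (auto simp: majorant_series_solution_def)
qed

lemma fps_agree_majorant_rhs:
  "fps_agree n f f' \<Longrightarrow> fps_agree n (majorant_rhs f) (majorant_rhs f')"
  unfolding majorant_rhs_def
  by (intro fps_agree_mult fps_agree_rpow fps_agree_diff fps_agree_power fps_agree_refl)

lemma majorant_series_solution_ex1: "\<exists>!\<rho>. majorant_series_solution nu mu \<rho>"
proof (rule ex_ex1I)
  define R :: "(nat \<Rightarrow> real \<times> real) \<Rightarrow> real fps" where "R c = Abs_fps (\<lambda>k. fst (c k))" for c
  define F :: "(nat \<Rightarrow> real \<times> real) \<Rightarrow> nat \<Rightarrow> real \<times> real"
    where "F c n = (snd (c n) / real (Suc n), nu * fps_nth (majorant_rhs (R c)) n / real (Suc n))"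
    for c n
  have "F c n = F c' n" if "\<And>k. k \<le> n \<Longrightarrow> c k = c' k" for c c' n
  proof -
    have "fps_agree n (R c) (R c')" using that by (simp add: fps_agree_def R_def)
    then have "fps_agree n (majorant_rhs (R c)) (majorant_rhs (R c'))"
      by (rule fps_agree_majorant_rhs)
    then show ?thesis using that by (simp add: F_def fps_agree_def)
  qed
  from exists_causal_sequence[of F, OF this]
  obtain c where c0: "c 0 = (1, mu)" and c1: "\<And>n. c (Suc n) = F c n"
    by blast
  have "fps_deriv (R c) = Abs_fps (\<lambda>k. snd (c k))"
    by (simp add: fps_eq_iff R_def c1 F_def del: of_nat_Suc)
  moreover have "fps_deriv (Abs_fps (\<lambda>k. snd (c k))) = fps_const nu * majorant_rhs (R c)"
    by (simp add: fps_eq_iff c1 F_def del: of_nat_Suc)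
  moreover have "fps_nth (R c) 0 = 1" "fps_nth (R c) 1 = mu"
    by (simp_all add: R_def c0 c1 F_def)
  ultimately show "\<exists>\<rho>. majorant_series_solution nu mu \<rho>"
    unfolding majorant_series_solution_alt by (intro exI[of _ "R c"]) simp
next
  fix f f'
  assume sol: "majorant_series_solution nu mu f" "majorant_series_solution nu mu f'"
  have "fps_agree (Suc n) f f'" for n
  proof (induction n)
    case 0
    then show ?case
      using sol by (auto simp: majorant_series_solution_alt fps_agree_def le_Suc_eq)
  next
    case (Suc n)
    then have "fps_agree (Suc n) (majorant_rhs f) (majorant_rhs f')"
      by (rule fps_agree_majorant_rhs)
    then have "fps_nth (fps_deriv (fps_deriv f)) n = fps_nth (fps_deriv (fps_deriv f')) n"
      using sol by (simp add: majorant_series_solution_alt fps_agree_def del: fps_deriv_nth)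
    then have "fps_nth f (Suc (Suc n)) = fps_nth f' (Suc (Suc n))"
      by (simp del: of_nat_Suc)
    with Suc show ?case by (auto simp: fps_agree_def le_Suc_eq)
  qed
  then show "f = f'" unfolding fps_eq_iff fps_agree_def by (metis le_SucI order_refl)
qed

lemma fps_mult_nth_nonneg:
  fixes f g :: "real fps"
  assumes "\<And>k. k \<le> n \<Longrightarrow> fps_nth f k \<ge> 0" "\<And>k. k \<le> n \<Longrightarrow> fps_nth g k \<ge> 0" "k \<le> n"
  shows "fps_nth (f * g) k \<ge> 0"
  unfolding fps_mult_nth using assms by (intro sum_nonneg mult_nonneg_nonneg) auto

lemma fps_power_nth_nonneg:
  fixes f :: "real fps"
  assumes "\<And>k. k \<le> n \<Longrightarrow> fps_nth f k \<ge> 0" "k \<le> n"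
  shows "fps_nth (f ^ i) k \<ge> 0"
  using assms(2)
proof (induction i arbitrary: k)
  case 0
  then show ?case by (simp add: fps_one_nth)
next
  case (Suc i)
  show ?case
    unfolding power_Suc by (rule fps_mult_nth_nonneg[of n]) (use assms Suc in auto)
qed

lemma majorant_rhs_nonneg:
  assumes "fps_nth \<rho> 0 = 1" and nonneg: "\<And>k. k \<le> n \<Longrightarrow> fps_nth \<rho> k \<ge> 0"
  shows "fps_nth (majorant_rhs \<rho>) n \<ge> 0"
proof -
  define w where "w = \<rho>\<^sup>2 - 1"
  have w: "fps_nth w k \<ge> 0" if "k \<le> n" for k
    using fps_power_nth_nonneg[of n \<rho> k 2] assms that
    by (cases "k = 0") (auto simp: w_def power2_eq_square)
  have eq: "fps_rpow (2 - \<rho>\<^sup>2) (- (3/2)) = fps_compose (fps_binomial (- (3/2))) (- w)"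
  proof -
    have "fps_nth (2 - \<rho>\<^sup>2) 0 = 1"
      using assms(1) by (simp add: fps_numeral_nth power2_eq_square)
    moreover have "2 - \<rho>\<^sup>2 - 1 = - w"
      by (simp add: w_def)
    ultimately show ?thesis by (simp only: fps_rpow_def) simp
  qed
  have coeff: "((- (3/2)) gchoose i) * fps_nth ((- w) ^ i) k
        = pochhammer (3/2) i / fact i * fps_nth (w ^ i) k" for i k
  proof -
    have "(- w) ^ i = fps_const ((- 1) ^ i) * w ^ i"
      by (simp add: power_minus[of w] flip: fps_const_power fps_const_neg)
    moreover have "(- 1 :: real) ^ i * (- 1) ^ i = 1"
      by (simp flip: power_mult_distrib)
    ultimately show ?thesis
      by (simp add: gbinomial_pochhammer)
  qed
  have "fps_nth (fps_rpow (2 - \<rho>\<^sup>2) (- (3/2))) k \<ge> 0" if "k \<le> n" for k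
    unfolding eq fps_compose_nth fps_binomial_nth coeff
    using fps_power_nth_nonneg[of n w, OF w that]
    by (intro sum_nonneg mult_nonneg_nonneg divide_nonneg_nonneg) (auto simp: pochhammer_nonneg)
  then show ?thesis
    unfolding majorant_rhs_def using nonneg by (intro fps_mult_nth_nonneg[of n]) auto
qed

lemma majorant_series_solution_nonneg:
  assumes sol: "majorant_series_solution nu mu \<rho>" and "nu \<ge> 0" "mu \<ge> 0"
  shows "fps_nth \<rho> k \<ge> 0"
proof -
  have "\<forall>k\<le>Suc n. fps_nth \<rho> k \<ge> 0" for n
  proof (induction n)
    case 0
    then show ?case
      using assms by (auto simp: majorant_series_solution_alt le_Suc_eq)
  next
    case (Suc n)
    then have "fps_nth (majorant_rhs \<rho>) n \<ge> 0"
      using sol by (intro majorant_rhs_nonneg) (auto simp: majorant_series_solution_alt)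
    then have "fps_nth (fps_deriv (fps_deriv \<rho>)) n \<ge> 0"
      using sol assms(2) by (simp add: majorant_series_solution_alt del: fps_deriv_nth)
    then have "fps_nth \<rho> (Suc (Suc n)) \<ge> 0"
      by (simp add: zero_le_mult_iff del: of_nat_Suc)
    with Suc show ?case by (auto simp: le_Suc_eq)
  qed
  then show ?thesis by (metis le_SucI order_refl)
qed

lemma Max_pairs_nonneg:
  assumes "N \<ge> 2" and "\<And>i j. f i j \<ge> (0::real)"
  shows "Max {f i j | i j. 1 \<le> i \<and> i < j \<and> j \<le> (N::nat)} \<ge> 0"
proof -
  have "{f i j | i j. 1 \<le> i \<and> i < j \<and> j \<le> N} \<subseteq> (\<lambda>(i, j). f i j) ` ({..N} \<times> {..N})"
    by auto
  then have "finite {f i j | i j. 1 \<le> i \<and> i < j \<and> j \<le> N}"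
    by (rule finite_subset) simp
  moreover have "f 1 2 \<in> {f i j | i j. 1 \<le> i \<and> i < j \<and> j \<le> N}"
    using assms(1) by force
  ultimately have "f 1 2 \<le> Max {f i j | i j. 1 \<le> i \<and> i < j \<and> j \<le> N}"
    by (rule Max_ge)
  with assms(2)[of 1 2] show ?thesis by linarith
qed

lemma grav_mu_nonneg: "N \<ge> 2 \<Longrightarrow> grav_mu N q v \<ge> 0"
  unfolding grav_mu_def by (rule Max_pairs_nonneg) auto

lemma grav_nu_nonneg:
  assumes "N \<ge> 2" "G > 0" "\<And>i. i \<in> {1..N} \<Longrightarrow> m i > 0"
  shows "grav_nu N G m q \<ge> 0"
proof -
  have "grav_K N G m q i \<ge> 0" for i
    unfolding grav_K_def using assms(2,3)
    by (intro sum_nonneg divide_nonneg_nonneg mult_nonneg_nonneg) (auto intro: less_imp_le)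
  then show ?thesis
    unfolding grav_nu_def using assms(1)
    by (intro Max_pairs_nonneg) (auto simp: grav_M_def)
qed

end

theory Submission
  imports Defs
begin

text \<open>
  Write \<open>d\<^sub>i\<^sub>j = \<parallel>q\<^sub>i\<^sup>0 - q\<^sub>j\<^sup>0\<parallel>\<close>. Majorization is compatible with sums, products and
  composition of series. If \<open>r = q\<^sub>i - q\<^sub>j\<close> is
  majored by \<open>d\<^sub>i\<^sub>j \<rho>\<close>, then \<open>r \<bullet> r = d\<^sub>i\<^sub>j\<^sup>2 (1 + u)\<close>, where \<open>u\<close> has no constant term and is majored by
  \<open>\<rho>\<^sup>2 - 1\<close>. The coefficients of \<open>(1 - x)\<close> to the power \<open>-3/2\<close> are nonnegative and are the absolute
  values of those of \<open>(1 + x)\<close> to the same power, so substituting \<open>1 - (\<rho>\<^sup>2 - 1) = 2 - \<rho>\<^sup>2\<close> shows that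
  \<open>r / \<parallel>r\<parallel>\<^sup>3\<close> is majored by \<open>1 / d\<^sub>i\<^sub>j\<^sup>2\<close> times \<open>\<rho> / (2 - \<rho>\<^sup>2)\<^sup>3\<^sup>/\<^sup>2\<close>
  (\<open>majored_upto_grav_term\<close>). Summing over the bodies, the acceleration of body \<open>i\<close> is majored by
  \<open>K\<^sub>i(q\<^sup>0)\<close> times that same scalar series (\<open>majored_upto_grav_g\<close>).

  The equations of motion determine each coefficient from earlier ones, so the majorization of
  the differences propagates from order to order: the second derivative of \<open>q\<^sub>i - q\<^sub>j\<close> is majored with
  constant \<open>K\<^sub>i + K\<^sub>j = M\<^sub>i\<^sub>j\<close>, at most the constant \<open>\<nu> d\<^sub>i\<^sub>j\<close> of the equation for
  \<open>d\<^sub>i\<^sub>j \<rho>\<close>, and the initial velocities are compared through \<open>\<mu>\<close>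
  (\<open>nbody_differences_majored\<close>). The bound for a single body is one further use of the acceleration
  estimate, since \<open>K\<^sub>i \<le> M\<^sub>i\<^sub>j \<le> \<nu> d\<^sub>i\<^sub>j\<close> for every \<open>j \<noteq> i\<close>, the nearest body included.
\<close>

section \<open>Majorization up to a given order\<close>

text \<open>
  The induction on the order of the coefficients knows the majorization only for an initial
  segment. The acceleration up to order \<open>n\<close> depends only on the positions up to order \<open>n\<close>, so a
  truncated relation suffices there.
\<close>
definition majored_upto :: "nat \<Rightarrow> 'a::real_normed_vector fps \<Rightarrow> real fps \<Rightarrow> bool" where
  "majored_upto n f F \<longleftrightarrow> (\<forall>k\<le>n. norm (fps_nth f k) \<le> fps_nth F k)"

lemma majored_uptoD: "majored_upto n f F \<Longrightarrow> k \<le> n \<Longrightarrow> norm (fps_nth f k) \<le> fps_nth F k"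
  by (simp add: majored_upto_def)

lemma majored_upto_nonneg: "majored_upto n f F \<Longrightarrow> k \<le> n \<Longrightarrow> 0 \<le> fps_nth F k"
  using majored_uptoD norm_ge_zero order_trans by blast

lemma majored_upto_const: "norm c \<le> C \<Longrightarrow> majored_upto n (fps_const c) (fps_const C)"
  by (auto simp: majored_upto_def)

lemma majored_upto_sum:
  assumes "\<And>j. j \<in> A \<Longrightarrow> majored_upto n (f j) (F j)"
  shows "majored_upto n (\<Sum>j\<in>A. f j) (\<Sum>j\<in>A. F j)"
  using assms by (auto simp: majored_upto_def fps_sum_nth intro!: sum_norm_le)

lemma majored_upto_scaleR:
  assumes p: "majored_upto n p P" and f: "majored_upto n f F"
  shows "majored_upto n (fps_scaleR p f) (P * F)"
  unfolding majored_upto_def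
proof (intro allI impI)
  fix k assume k: "k \<le> n"
  have "norm (\<Sum>l\<le>k. fps_nth p l *\<^sub>R fps_nth f (k - l)) \<le> (\<Sum>l\<le>k. fps_nth P l * fps_nth F (k - l))"
  proof (rule sum_norm_le)
    fix l assume "l \<in> {..k}"
    then have "l \<le> n" "k - l \<le> n" using k by auto
    then show "norm (fps_nth p l *\<^sub>R fps_nth f (k - l)) \<le> fps_nth P l * fps_nth F (k - l)"
      using majored_uptoD[OF p] majored_uptoD[OF f] majored_upto_nonneg[OF p]
      by (simp add: mult_mono)
  qed
  then show "norm (fps_nth (fps_scaleR p f) k) \<le> fps_nth (P * F) k"
    by (simp add: fps_scaleR_def fps_mult_nth atLeast0AtMost)
qed

lemma majored_upto_mult:
  fixes f g :: "real fps"
  assumes "majored_upto n f F" "majored_upto n g H"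
  shows "majored_upto n (f * g) (F * H)"
proof -
  have "f * g = fps_scaleR f g"
    by (simp add: fps_eq_iff fps_scaleR_def fps_mult_nth atLeast0AtMost)
  then show ?thesis using majored_upto_scaleR[OF assms] by simp
qed

lemma majored_upto_power:
  fixes f :: "real fps"
  assumes "majored_upto n f F"
  shows "majored_upto n (f ^ i) (F ^ i)"
proof (induction i)
  case 0
  show ?case by (simp add: majored_upto_def fps_one_nth)
next
  case (Suc i)
  then show ?case using majored_upto_mult[OF assms] by simp
qed

lemma majored_upto_norm_sq:
  assumes f: "majored_upto n f F"
  shows "majored_upto n (fps_norm_sq f) (F\<^sup>2)"
  unfolding majored_upto_def
proof (intro allI impI)
  fix k assume k: "k \<le> n"
  have "norm (\<Sum>l\<le>k. fps_nth f l \<bullet> fps_nth f (k - l)) \<le> (\<Sum>l\<le>k. fps_nth F l * fps_nth F (k - l))"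
  proof (rule sum_norm_le)
    fix l assume "l \<in> {..k}"
    then have l: "l \<le> n" "k - l \<le> n" using k by auto
    have "norm (fps_nth f l \<bullet> fps_nth f (k - l)) \<le> norm (fps_nth f l) * norm (fps_nth f (k - l))"
      using Cauchy_Schwarz_ineq2 by simp
    also have "\<dots> \<le> fps_nth F l * fps_nth F (k - l)"
      using l majored_uptoD[OF f] majored_upto_nonneg[OF f] by (intro mult_mono) auto
    finally show "norm (fps_nth f l \<bullet> fps_nth f (k - l)) \<le> fps_nth F l * fps_nth F (k - l)" .
  qed
  then show "norm (fps_nth (fps_norm_sq f) k) \<le> fps_nth (F\<^sup>2) k"
    by (simp add: fps_norm_sq_def fps_mult_nth atLeast0AtMost power2_eq_square)
qed

lemma majored_upto_compose:
  fixes a u :: "real fps"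
  assumes a: "majored_upto n a A" and u: "majored_upto n u U"
  shows "majored_upto n (fps_compose a u) (fps_compose A U)"
  unfolding majored_upto_def
proof (intro allI impI)
  fix k assume k: "k \<le> n"
  show "norm (fps_nth (fps_compose a u) k) \<le> fps_nth (fps_compose A U) k"
    unfolding fps_compose_nth
  proof (rule sum_norm_le)
    fix i assume "i \<in> {0..k}"
    then have "i \<le> n" using k by simp
    then show "norm (fps_nth a i * fps_nth (u ^ i) k) \<le> fps_nth A i * fps_nth (U ^ i) k"
      unfolding norm_mult
      using k majored_uptoD[OF a] majored_uptoD[OF majored_upto_power[OF u]] majored_upto_nonneg[OF a]
      by (intro mult_mono) auto
  qed
qed


section \<open>Majorization of the gravitational attraction\<close>

text \<open>
  The \<open>i\<close>-th binomial coefficient of a negative exponent has sign \<open>(-1)\<^sup>i\<close>, so passing from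
  \<open>1 + x\<close> to \<open>1 - x\<close> replaces every coefficient by its absolute value.
\<close>
lemma majored_upto_binomial:
  fixes u w :: "real fps"
  assumes "a > 0" and u: "majored_upto n u w"
  shows "majored_upto n (fps_compose (fps_binomial (- a)) u) (fps_compose (fps_binomial (- a)) (- w))"
proof -
  define B where "B = Abs_fps (\<lambda>i. pochhammer a i / fact i)"
  have "fps_compose (fps_binomial (- a)) (- w) = fps_compose B w"
  proof (rule fps_ext)
    fix k
    have "((- a) gchoose i) * fps_nth ((- w) ^ i) k = fps_nth B i * fps_nth (w ^ i) k" for i
    proof -
      have "(- w) ^ i = fps_const ((- 1) ^ i) * w ^ i"
        by (simp add: power_minus[of w] flip: fps_const_power fps_const_neg)
      moreover have "(- 1 :: real) ^ i * (- 1) ^ i = 1"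
        by (simp flip: power_mult_distrib)
      ultimately show ?thesis
        by (simp add: B_def gbinomial_pochhammer)
    qed
    then show "fps_nth (fps_compose (fps_binomial (- a)) (- w)) k = fps_nth (fps_compose B w) k"
      by (simp add: fps_compose_nth)
  qed
  moreover have "majored_upto n (fps_binomial (- a)) B"
    using \<open>a > 0\<close>
    by (simp add: majored_upto_def B_def gbinomial_pochhammer abs_mult power_abs pochhammer_nonneg)
  ultimately show ?thesis
    using majored_upto_compose u by metis
qed

text \<open>
  The constant term of \<open>r\<close> has norm \<open>d\<close>, so dividing \<open>r \<bullet> r\<close> by \<open>d\<^sup>2\<close> leaves a series \<open>1 + u\<close>.
  It is \<open>u\<close> that is compared with \<open>\<rho>\<^sup>2 - 1\<close>: both have constant term zero, whereas comparing
  \<open>1 + u\<close> with \<open>\<rho>\<^sup>2\<close> would say nothing about negative powers.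
\<close>
lemma majored_upto_inverse_cube:
  fixes r :: "'a::real_inner fps"
  assumes d: "d = norm (fps_nth r 0)" "d > 0" and \<rho>: "fps_nth \<rho> 0 = 1"
    and r: "majored_upto n r (fps_const d * \<rho>)"
  shows "majored_upto n (fps_rpow (fps_norm_sq r) (- (3/2)))
           (fps_const (1 / d ^ 3) * fps_rpow (2 - \<rho>\<^sup>2) (- (3/2)))"
proof -
  define u where "u = fps_const (1 / d\<^sup>2) * fps_norm_sq r - 1"
  have sq0: "fps_nth (fps_norm_sq r) 0 = d\<^sup>2"
    by (simp add: fps_norm_sq_def d power2_norm_eq_inner)
  have "majored_upto n (fps_const (1 / d\<^sup>2) * fps_norm_sq r) (fps_const (1 / d\<^sup>2) * (fps_const d * \<rho>)\<^sup>2)"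
    by (intro majored_upto_mult majored_upto_norm_sq r majored_upto_const) simp
  also have "fps_const (1 / d\<^sup>2) * (fps_const d * \<rho>)\<^sup>2 = \<rho>\<^sup>2"
    using d(2) by (simp add: power_mult_distrib fps_const_power flip: mult.assoc)
  finally have scaled: "majored_upto n (fps_const (1 / d\<^sup>2) * fps_norm_sq r) (\<rho>\<^sup>2)" .
  have "majored_upto n u (\<rho>\<^sup>2 - 1)"
    unfolding majored_upto_def
  proof (intro allI impI)
    fix k assume "k \<le> n"
    then show "norm (fps_nth u k) \<le> fps_nth (\<rho>\<^sup>2 - 1) k"
      using majored_uptoD[OF scaled] sq0 \<rho> d(2)
      by (cases "k = 0") (auto simp: u_def power2_eq_square)
  qed
  then have "majored_upto n (fps_compose (fps_binomial (- (3/2))) u)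
      (fps_compose (fps_binomial (- (3/2))) (- (\<rho>\<^sup>2 - 1)))"
    by (intro majored_upto_binomial) simp_all
  moreover have "fps_rpow (2 - \<rho>\<^sup>2) (- (3/2)) = fps_compose (fps_binomial (- (3/2))) (- (\<rho>\<^sup>2 - 1))"
  proof -
    have "fps_nth (2 - \<rho>\<^sup>2) 0 = 1"
      using \<rho> by (simp add: fps_numeral_nth power2_eq_square)
    moreover have "2 - \<rho>\<^sup>2 - 1 = - (\<rho>\<^sup>2 - 1)" by simp
    ultimately show ?thesis by (simp only: fps_rpow_def) simp
  qed
  moreover have "fps_rpow (fps_norm_sq r) (- (3/2))
      = fps_const (1 / d ^ 3) * fps_compose (fps_binomial (- (3/2))) u"
  proof -
    have "d\<^sup>2 powr (- (3/2)) = 1 / d ^ 3"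
    proof -
      have "d\<^sup>2 powr (- (3/2)) = d powr (- 3)"
        using d(2) by (simp add: powr_powr flip: powr_numeral)
      also have "\<dots> = 1 / d ^ 3"
        using d(2) by (simp add: powr_minus_divide)
      finally show ?thesis .
    qed
    then show ?thesis by (simp add: fps_rpow_def sq0 u_def)
  qed
  ultimately show ?thesis
    by (metis majored_upto_const majored_upto_mult order_refl norm_divide norm_power norm_one
        abs_of_pos d(2) real_norm_def)
qed

text \<open>
  Of the three factors \<open>1 / d\<close> from the inverse cube, one is cancelled by the factor \<open>d\<close>
  that comes with \<open>\<rho>\<close> in the bound for \<open>r\<close> itself; this is how the constants of \<open>K\<^sub>i\<close> arise.
\<close>
lemma majored_upto_grav_term:
  fixes r :: "'a::real_inner fps"
  assumes d: "d = norm (fps_nth r 0)" "d > 0" and \<rho>: "fps_nth \<rho> 0 = 1" and "c \<ge> 0"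
    and r: "majored_upto n r (fps_const d * \<rho>)"
  shows "majored_upto n (fps_scaleR (fps_const c / fps_rpow (fps_norm_sq r) (3/2)) r)
           (fps_const (c / d\<^sup>2) * majorant_rhs \<rho>)"
proof -
  have "fps_const c / fps_rpow (fps_norm_sq r) (3/2) = fps_const c * fps_rpow (fps_norm_sq r) (- (3/2))"
    by (rule divide_fps_rpow) (simp add: fps_norm_sq_def)
  moreover have "majored_upto n (fps_scaleR (fps_const c * fps_rpow (fps_norm_sq r) (- (3/2))) r)
      (fps_const c * (fps_const (1 / d ^ 3) * fps_rpow (2 - \<rho>\<^sup>2) (- (3/2))) * (fps_const d * \<rho>))"
    by (intro majored_upto_scaleR majored_upto_mult majored_upto_const
        majored_upto_inverse_cube[OF d \<rho> r] r) (simp add: \<open>c \<ge> 0\<close>)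
  moreover have "fps_const c * (fps_const (1 / d ^ 3) * fps_rpow (2 - \<rho>\<^sup>2) (- (3/2))) * (fps_const d * \<rho>)
      = fps_const (c / d\<^sup>2) * majorant_rhs \<rho>"
  proof -
    have "fps_const (c / d\<^sup>2) = fps_const c * fps_const (1 / d ^ 3) * fps_const d"
      using d(2) by (simp add: power2_eq_square power3_eq_cube)
    then show ?thesis
      by (simp only: majorant_rhs_def ac_simps)
  qed
  ultimately show ?thesis by simp
qed

lemma fps_norm_sq_minus: "fps_norm_sq (f - g) = fps_norm_sq (g - f)"
proof -
  have "(a - b) \<bullet> (c - e) = (b - a) \<bullet> (e - c)" for a b c e :: 'a
    by (simp add: inner_diff_left inner_diff_right)
  then show ?thesis
    unfolding fps_norm_sq_def fps_sub_nth by presburger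
qed

lemma majored_upto_grav_g:
  assumes "i \<in> {1..N}" and "\<And>j. j \<in> {1..N} \<Longrightarrow> m j > 0" and "G > 0" and \<rho>: "fps_nth \<rho> 0 = 1"
    and q0: "\<And>j. j \<in> {1..N} \<Longrightarrow> fps_nth (q j) 0 = q0 j"
    and ne: "\<And>j. j \<in> {1..N} - {i} \<Longrightarrow> q0 i \<noteq> q0 j"
    and maj: "\<And>j. j \<in> {1..N} - {i} \<Longrightarrow> majored_upto n (q j - q i) (fps_const (norm (q0 j - q0 i)) * \<rho>)"
  shows "majored_upto n (grav_g_fps N G m q i) (fps_const (grav_K N G m q0 i) * majorant_rhs \<rho>)"
proof -
  have "majored_upto n (grav_g_fps N G m q i)
      (\<Sum>j\<in>{1..N} - {i}. fps_const (G * m j / (norm (q0 j - q0 i))\<^sup>2) * majorant_rhs \<rho>)"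
    unfolding grav_g_fps_def
  proof (rule majored_upto_sum)
    fix j assume j: "j \<in> {1..N} - {i}"
    then show "majored_upto n
        (fps_scaleR (fps_const (G * m j) / fps_rpow (fps_norm_sq (q i - q j)) (3/2)) (q j - q i))
        (fps_const (G * m j / (norm (q0 j - q0 i))\<^sup>2) * majorant_rhs \<rho>)"
      unfolding fps_norm_sq_minus[of "q i"]
      using assms(1-3) q0 ne[OF j] \<rho> maj[OF j]
      by (intro majored_upto_grav_term) (auto intro: less_imp_le)
  qed
  also have "(\<Sum>j\<in>{1..N} - {i}. fps_const (G * m j / (norm (q0 j - q0 i))\<^sup>2) * majorant_rhs \<rho>)
      = fps_const (grav_K N G m q0 i) * majorant_rhs \<rho>"
    by (rule fps_ext)
      (simp add: grav_K_def fps_sum_nth sum_distrib_right norm_minus_commute[of "q0 i"])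
  finally show ?thesis .
qed


section \<open>The extremal constants \<open>\<mu>\<close> and \<open>\<nu>\<close>\<close>

lemma le_Max_pairs:
  fixes f :: "nat \<Rightarrow> nat \<Rightarrow> real"
  assumes "\<And>i j. f i j = f j i" "i \<in> {1..N}" "j \<in> {1..N}" "i \<noteq> j"
  shows "f i j \<le> Max {f i j | i j. 1 \<le> i \<and> i < j \<and> j \<le> N}"
proof (rule Max_ge)
  have "{f i j | i j. 1 \<le> i \<and> i < j \<and> j \<le> N} \<subseteq> (\<lambda>(i, j). f i j) ` ({..N} \<times> {..N})"
    by auto
  then show "finite {f i j | i j. 1 \<le> i \<and> i < j \<and> j \<le> N}"
    by (rule finite_subset) simp
  show "f i j \<in> {f i j | i j. 1 \<le> i \<and> i < j \<and> j \<le> N}"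
    using assms by (cases "i < j") (auto, metis nat_neq_iff)
qed

lemma norm_diff_velocity_le:
  assumes "i \<in> {1..N}" "j \<in> {1..N}" "i \<noteq> j" "q i \<noteq> q j"
  shows "norm (v i - v j) \<le> norm (q i - q j) * grav_mu N q v"
proof -
  have "norm (v i - v j) / norm (q i - q j) \<le> grav_mu N q v"
    unfolding grav_mu_def
    by (rule le_Max_pairs) (use assms in \<open>auto simp: norm_minus_commute\<close>)
  then show ?thesis using assms(4) by (simp add: field_simps)
qed

lemma grav_M_le:
  assumes "i \<in> {1..N}" "j \<in> {1..N}" "i \<noteq> j" "q i \<noteq> q j"
  shows "grav_M N G m q i j \<le> norm (q i - q j) * grav_nu N G m q"
proof -
  have "grav_M N G m q i j / norm (q i - q j) \<le> grav_nu N G m q"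
    unfolding grav_nu_def
    by (rule le_Max_pairs) (use assms in \<open>auto simp: norm_minus_commute grav_M_def\<close>)
  then show ?thesis using assms(4) by (simp add: field_simps)
qed

lemma grav_K_nonneg:
  assumes "G > 0" "\<And>i. i \<in> {1..N} \<Longrightarrow> m i > 0"
  shows "grav_K N G m q i \<ge> 0"
  unfolding grav_K_def using assms
  by (intro sum_nonneg divide_nonneg_nonneg mult_nonneg_nonneg) (auto intro: less_imp_le)


section \<open>Propagation of the majorization\<close>

lemma nbody_nth_Suc_Suc:
  assumes "nbody_series_solution N G m q0 v0 q v" "i \<in> {1..N}"
  shows "(real (Suc n) * real (Suc (Suc n))) *\<^sub>R fps_nth (q i) (Suc (Suc n))
         = fps_nth (grav_g_fps N G m q i) n"
proof -
  have "fps_nth (grav_g_fps N G m q i) n = fps_nth (fps_deriv (fps_deriv (q i))) n"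
    using assms by (simp add: nbody_series_solution_def del: fps_deriv_nth)
  then show ?thesis
    by (simp add: fps_deriv_vec_nth del: fps_deriv_nth of_nat_Suc)
qed

lemma majorant_nth_Suc_Suc:
  assumes "majorant_series_solution nu mu \<rho>"
  shows "(real (Suc n) * real (Suc (Suc n))) * fps_nth \<rho> (Suc (Suc n))
         = nu * fps_nth (majorant_rhs \<rho>) n"
proof -
  have "nu * fps_nth (majorant_rhs \<rho>) n = fps_nth (fps_deriv (fps_deriv \<rho>)) n"
    using assms by (simp add: majorant_series_solution_alt del: fps_deriv_nth)
  then show ?thesis by (simp del: of_nat_Suc)
qed

text \<open>
  One step of the comparison: both equations of second order divide the coefficient of their
  right-hand side by the same positive number.
\<close>
lemma norm_nth_Suc_Suc_le:
  fixes x :: "'a::real_normed_vector"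
  assumes "majorant_series_solution nu mu \<rho>"
    and "norm ((real (Suc n) * real (Suc (Suc n))) *\<^sub>R x) \<le> K * fps_nth (majorant_rhs \<rho>) n"
    and "K \<le> d * nu" and "fps_nth (majorant_rhs \<rho>) n \<ge> 0"
  shows "norm x \<le> d * fps_nth \<rho> (Suc (Suc n))"
proof -
  let ?c = "real (Suc n) * real (Suc (Suc n))"
  have c: "?c > 0" by simp
  have "?c * norm x = norm (?c *\<^sub>R x)"
    using c by (simp only: norm_scaleR abs_of_pos)
  also have "\<dots> \<le> d * nu * fps_nth (majorant_rhs \<rho>) n"
    using assms(2) mult_right_mono[OF assms(3,4)] by linarith
  also have "\<dots> = ?c * (d * fps_nth \<rho> (Suc (Suc n)))"
    using majorant_nth_Suc_Suc[OF assms(1), of n] by (metis mult.assoc mult.left_commute)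
  finally show ?thesis using c by (simp only: mult_le_cancel_left_pos)
qed

context
  fixes N :: nat and G :: real and m :: "nat \<Rightarrow> real"
    and q0 v0 :: "nat \<Rightarrow> real ^ 3"
    and q v :: "nat \<Rightarrow> (real ^ 3) fps"
    and \<rho> :: "real fps"
  assumes N: "N \<ge> 2"
    and m: "\<And>i. i \<in> {1..N} \<Longrightarrow> m i > 0"
    and G: "G > 0"
    and distinct: "\<And>i j. i \<in> {1..N} \<Longrightarrow> j \<in> {1..N} \<Longrightarrow> i \<noteq> j \<Longrightarrow> q0 i \<noteq> q0 j"
    and sol: "nbody_series_solution N G m q0 v0 q v"
    and maj: "majorant_series_solution (grav_nu N G m q0) (grav_mu N q0 v0) \<rho>"
begin

lemma q_nth: "i \<in> {1..N} \<Longrightarrow> fps_nth (q i) 0 = q0 i" "i \<in> {1..N} \<Longrightarrow> fps_nth (q i) (Suc 0) = v0 i"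
proof -
  assume i: "i \<in> {1..N}"
  then show "fps_nth (q i) 0 = q0 i" using sol by (simp add: nbody_series_solution_def)
  have "fps_nth (fps_deriv (q i)) 0 = v0 i"
    using sol i by (simp add: nbody_series_solution_def del: fps_deriv_nth)
  then show "fps_nth (q i) (Suc 0) = v0 i"
    by (simp add: fps_deriv_vec_nth del: fps_deriv_nth)
qed

lemma \<rho>_nth: "fps_nth \<rho> 0 = 1" "fps_nth \<rho> (Suc 0) = grav_mu N q0 v0"
  using maj by (simp_all add: majorant_series_solution_alt)

lemma majorant_rhs_nth_nonneg: "fps_nth (majorant_rhs \<rho>) n \<ge> 0"
  using majorant_series_solution_nonneg[OF maj grav_nu_nonneg[OF N G m] grav_mu_nonneg[OF N]] \<rho>_nth(1)
  by (intro majorant_rhs_nonneg) auto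

text \<open>
  The equations are of second order, so the induction starts with the coefficients of orders
  0 and 1, where the claim compares the initial data. Orders up to \<open>n\<close> then bound the
  accelerations at order \<open>n\<close>, hence the differences at order \<open>n + 2\<close>.
\<close>
lemma nbody_differences_majored_upto:
  "i \<in> {1..N} \<Longrightarrow> j \<in> {1..N} \<Longrightarrow> i \<noteq> j \<Longrightarrow>
     majored_upto (Suc n) (q i - q j) (fps_const (norm (q0 i - q0 j)) * \<rho>)"
proof (induction n arbitrary: i j)
  case 0
  then show ?case
    using norm_diff_velocity_le[OF 0 distinct[OF 0], of v0]
    by (auto simp: majored_upto_def le_Suc_eq q_nth \<rho>_nth)
next
  case (Suc n)
  let ?R = "majorant_rhs \<rho>" and ?c = "real (Suc n) * real (Suc (Suc n))"
  have g: "norm (fps_nth (grav_g_fps N G m q k) n) \<le> grav_K N G m q0 k * fps_nth ?R n"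
    if k: "k \<in> {1..N}" for k
  proof -
    have "majored_upto n (grav_g_fps N G m q k) (fps_const (grav_K N G m q0 k) * ?R)"
    proof (rule majored_upto_grav_g)
      fix l assume "l \<in> {1..N} - {k}"
      then show "majored_upto n (q l - q k) (fps_const (norm (q0 l - q0 k)) * \<rho>)"
        using Suc.IH[of l k] k by (auto simp: majored_upto_def)
    qed (use k m G \<rho>_nth q_nth distinct in auto)
    then show ?thesis by (auto dest: majored_uptoD[of n _ _ n])
  qed
  have "norm (?c *\<^sub>R fps_nth (q i - q j) (Suc (Suc n)))
      = norm (fps_nth (grav_g_fps N G m q i) n - fps_nth (grav_g_fps N G m q j) n)"
    using nbody_nth_Suc_Suc[OF sol] Suc.prems by (simp only: fps_sub_nth scaleR_diff_right)
  also have "\<dots> \<le> grav_M N G m q0 i j * fps_nth ?R n"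
    using g[OF Suc.prems(1)] g[OF Suc.prems(2)]
      norm_triangle_ineq4[of "fps_nth (grav_g_fps N G m q i) n" "fps_nth (grav_g_fps N G m q j) n"]
    unfolding grav_M_def distrib_right by linarith
  finally have "norm (fps_nth (q i - q j) (Suc (Suc n))) \<le> norm (q0 i - q0 j) * fps_nth \<rho> (Suc (Suc n))"
    by (rule norm_nth_Suc_Suc_le[OF maj _ grav_M_le[OF Suc.prems distinct[OF Suc.prems]]
          majorant_rhs_nth_nonneg])
  with Suc.IH[OF Suc.prems] show ?case
    by (auto simp: majored_upto_def le_Suc_eq)
qed

lemma nbody_differences_majored:
  assumes "i \<in> {1..N}" "j \<in> {1..N}" "i \<noteq> j"
  shows "q i - q j \<unlhd> fps_const (norm (q0 i - q0 j)) * \<rho>"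
  unfolding majored_by_def
  using majored_uptoD[OF nbody_differences_majored_upto[OF assms]] by (meson le_SucI order_refl)

text \<open>
  The constant \<open>\<nu>\<close> refers to pairs, but it also controls a single body: \<open>K\<^sub>j \<ge> 0\<close> gives
  \<open>K\<^sub>i \<le> M\<^sub>i\<^sub>j\<close> for any partner \<open>j\<close>.
\<close>
lemma nbody_position_nth_le:
  assumes i: "i \<in> {1..N}" and j: "j \<in> {1..N}" "i \<noteq> j"
  shows "norm (fps_nth (q i) (Suc (Suc n))) \<le> norm (q0 i - q0 j) * fps_nth \<rho> (Suc (Suc n))"
proof (rule norm_nth_Suc_Suc_le[OF maj])
  have "majored_upto n (grav_g_fps N G m q i) (fps_const (grav_K N G m q0 i) * majorant_rhs \<rho>)"
  proof (rule majored_upto_grav_g)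
    fix l assume "l \<in> {1..N} - {i}"
    then show "majored_upto n (q l - q i) (fps_const (norm (q0 l - q0 i)) * \<rho>)"
      using nbody_differences_majored[of l i] i by (auto simp: majored_upto_def majored_by_def)
  qed (use i m G \<rho>_nth q_nth distinct in auto)
  then show "norm ((real (Suc n) * real (Suc (Suc n))) *\<^sub>R fps_nth (q i) (Suc (Suc n)))
      \<le> grav_K N G m q0 i * fps_nth (majorant_rhs \<rho>) n"
    unfolding nbody_nth_Suc_Suc[OF sol i] by (auto dest: majored_uptoD[of n _ _ n])
  have "grav_K N G m q0 j \<ge> 0"
    using G m by (rule grav_K_nonneg)
  then show "grav_K N G m q0 i \<le> norm (q0 i - q0 j) * grav_nu N G m q0"
    using grav_M_le[OF i j distinct[OF i j], of G m]
    by (simp add: grav_M_def)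
qed (rule majorant_rhs_nth_nonneg)

lemma nbody_position_majored:
  assumes i: "i \<in> {1..N}"
  shows "q i - fps_const (q0 i) - fps_scaleR fps_X (fps_const (v0 i)) \<unlhd>
           fps_const (Min ((\<lambda>j. norm (q0 i - q0 j)) ` ({1..N} - {i}))) *
           Abs_fps (\<lambda>k. if 2 \<le> k then fps_nth \<rho> k else 0)"
  unfolding majored_by_def
proof
  fix k
  let ?D = "(\<lambda>j. norm (q0 i - q0 j)) ` ({1..N} - {i})"
  have X: "fps_nth (fps_scaleR fps_X (fps_const (v0 i))) k = (if k = 1 then v0 i else 0)"
  proof -
    have "fps_nth (fps_scaleR fps_X (fps_const (v0 i))) k
        = (\<Sum>l\<le>k. if l = 1 then (if k = 1 then v0 i else 0) else 0)"
      unfolding fps_scaleR_def fps_nth_Abs_fps by (intro sum.cong) auto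
    then show ?thesis by simp
  qed
  have "(if i = 1 then 2 else 1) \<in> {1..N} - {i}" using N by auto
  then have "?D \<noteq> {}" by blast
  then have "Min ?D \<in> ?D" by (intro Min_in) auto
  then obtain j where j: "j \<in> {1..N}" "i \<noteq> j" "Min ?D = norm (q0 i - q0 j)" by blast
  consider "k = 0" | "k = 1" | n where "k = Suc (Suc n)"
    by (metis One_nat_def not0_implies_Suc)
  then show "norm (fps_nth (q i - fps_const (q0 i) - fps_scaleR fps_X (fps_const (v0 i))) k)
      \<le> fps_nth (fps_const (Min ?D) * Abs_fps (\<lambda>k. if 2 \<le> k then fps_nth \<rho> k else 0)) k"
  proof cases
    case (3 n)
    then show ?thesis using X j(3) nbody_position_nth_le[OF i j(1,2), of n] by simp
  qed (use X i in \<open>simp_all add: q_nth\<close>)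
qed

end

theorem theorem1:
  fixes N :: nat and G :: real and m :: "nat \<Rightarrow> real"
    and q0 v0 :: "nat \<Rightarrow> real ^ 3"
    and q v :: "nat \<Rightarrow> (real ^ 3) fps"
    and \<rho> :: "real fps"
  assumes "N \<ge> 2"
    and "\<And>i. i \<in> {1..N} \<Longrightarrow> m i > 0"
    and "G > 0"
    and "\<And>i j. 1 \<le> i \<Longrightarrow> i < j \<Longrightarrow> j \<le> N \<Longrightarrow> q0 i \<noteq> q0 j"
    and "nbody_series_solution N G m q0 v0 q v"
    and "majorant_series_solution (grav_nu N G m q0) (grav_mu N q0 v0) \<rho>"
  shows "(\<forall>i j. 1 \<le> i \<and> i < j \<and> j \<le> N \<longrightarrow>
            q i - q j \<unlhd> fps_const (norm (q0 i - q0 j)) * \<rho>) \<and>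
         (\<forall>i\<in>{1..N}.
            q i - fps_const (q0 i) - fps_scaleR fps_X (fps_const (v0 i)) \<unlhd>
              fps_const (Min ((\<lambda>j. norm (q0 i - q0 j)) ` ({1..N} - {i}))) *
              Abs_fps (\<lambda>k. if 2 \<le> k then fps_nth \<rho> k else 0))"
proof -
  have distinct: "q0 i \<noteq> q0 j" if "i \<in> {1..N}" "j \<in> {1..N}" "i \<noteq> j" for i j
    using assms(4)[of i j] assms(4)[of j i] that by (metis atLeastAtMost_iff nat_neq_iff)
  note solution = assms(1-3) distinct assms(5,6)
  show ?thesis
  proof (intro conjI allI impI ballI)
    fix i j assume "1 \<le> i \<and> i < j \<and> j \<le> N"
    then show "q i - q j \<unlhd> fps_const (norm (q0 i - q0 j)) * \<rho>"
      by (intro nbody_differences_majored[OF solution]) auto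
  qed (rule nbody_position_majored[OF solution])
qed

end
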